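(* Every homogeneous linear space is of one of the following forms: (T) a trivial linear space (the collinearity is trivial); (L) a line (the collinearity is total, i.e. all points are collinear); (P$_2$) the projective plane $\mathbb{F}_2\mathbf{P}^2$; (P$_3$) the projective plane $\mathbb{F}_3\mathbf{P}^2$.
   Context: A linear space is a pair $\langle X,\mathcal L\rangle$ where $X$ is a set (of points) and $\mathcal L$ is a family of subsets of $X$ (lines) such that every line has at least two points and any two different points lie on exactly one common line (so two different lines share at most one point). Points are collinear if some line contains all of them. Equivalently, a linear space is a structure with the ternary collinearity relation on $X$. An embedding of linear spaces is an injective map $f$ such that any three pairwise distinct points are collinear if and only if their images are collinear; an isomorphism is a bijective embedding. Any subset $Y\subseteq X$ is a subspace, with lines the sets $L\cap Y$ ($L\in\mathcal L$) having at least two points. A linear space is homogeneous if every isomorphism between finite subspaces of $X$ extends to an automorphism of $X$. A linear space is trivial if every line consists of exactly two points. $\mathbb{F}_q$ is the field with $q$ elements, and for a field $F$, $F\mathbf P^2$ is the linear space whose points are the $1$-dimensional subspaces of $F^3$ and whose lines are the $2$-dimensional subspaces of $F^3$ (each identified with the set of $1$-dimensional subspaces it contains). *)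

theory Defs
  imports "HOL-Analysis.Cartesian_Space"
begin

text \<open>
  A linear space is given by its set of points \<open>X\<close> and its set of lines \<open>\<L>\<close>, passed as two
  separate arguments. The carrier \<open>X\<close> is an arbitrary (possibly empty or infinite) set.
\<close>

definition linear_space :: "'a set \<Rightarrow> 'a set set \<Rightarrow> bool" where
  "linear_space X \<L> \<longleftrightarrow>
     (\<forall>L\<in>\<L>. L \<subseteq> X) \<and>
     (\<forall>L\<in>\<L>. \<exists>x\<in>L. \<exists>y\<in>L. x \<noteq> y) \<and>
     (\<forall>x\<in>X. \<forall>y\<in>X. x \<noteq> y \<longrightarrow> (\<exists>!L. L \<in> \<L> \<and> x \<in> L \<and> y \<in> L))"

definition collinear_in :: "'a set set \<Rightarrow> 'a set \<Rightarrow> bool" where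
  "collinear_in \<L> S \<longleftrightarrow> (\<exists>L\<in>\<L>. S \<subseteq> L)"

definition embedding ::
  "'a set \<Rightarrow> 'a set set \<Rightarrow> 'b set \<Rightarrow> 'b set set \<Rightarrow> ('a \<Rightarrow> 'b) \<Rightarrow> bool" where
  "embedding X \<L> Y \<M> f \<longleftrightarrow>
     f ` X \<subseteq> Y \<and> inj_on f X \<and>
     (\<forall>x\<in>X. \<forall>y\<in>X. \<forall>z\<in>X. x \<noteq> y \<and> y \<noteq> z \<and> x \<noteq> z \<longrightarrow>
        (collinear_in \<L> {x, y, z} \<longleftrightarrow> collinear_in \<M> {f x, f y, f z}))"

definition isomorphism ::
  "'a set \<Rightarrow> 'a set set \<Rightarrow> 'b set \<Rightarrow> 'b set set \<Rightarrow> ('a \<Rightarrow> 'b) \<Rightarrow> bool" where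
  "isomorphism X \<L> Y \<M> f \<longleftrightarrow> embedding X \<L> Y \<M> f \<and> bij_betw f X Y"

abbreviation automorphism :: "'a set \<Rightarrow> 'a set set \<Rightarrow> ('a \<Rightarrow> 'a) \<Rightarrow> bool" where
  "automorphism X \<L> \<equiv> isomorphism X \<L> X \<L>"

definition isomorphic_spaces ::
  "'a set \<Rightarrow> 'a set set \<Rightarrow> 'b set \<Rightarrow> 'b set set \<Rightarrow> bool" where
  "isomorphic_spaces X \<L> Y \<M> \<longleftrightarrow> (\<exists>f. isomorphism X \<L> Y \<M> f)"

definition subspace_lines :: "'a set set \<Rightarrow> 'a set \<Rightarrow> 'a set set" where
  "subspace_lines \<L> Y = {L \<inter> Y | L. L \<in> \<L> \<and> (\<exists>x\<in>L \<inter> Y. \<exists>y\<in>L \<inter> Y. x \<noteq> y)}"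

definition homogeneous :: "'a set \<Rightarrow> 'a set set \<Rightarrow> bool" where
  "homogeneous X \<L> \<longleftrightarrow>
     (\<forall>A B f. A \<subseteq> X \<and> B \<subseteq> X \<and> finite A \<and> finite B \<and>
        isomorphism A (subspace_lines \<L> A) B (subspace_lines \<L> B) f \<longrightarrow>
        (\<exists>g. automorphism X \<L> g \<and> (\<forall>a\<in>A. g a = f a)))"

definition trivial_space :: "'a set set \<Rightarrow> bool" where
  "trivial_space \<L> \<longleftrightarrow> (\<forall>L\<in>\<L>. card L = 2)"

definition PG2_points :: "('f::field ^ 3) set set" where
  "PG2_points = {P. vec.subspace P \<and> vec.dim P = 1}"

definition PG2_lines :: "('f::field ^ 3) set set set" where
  "PG2_lines = {{P \<in> PG2_points. P \<subseteq> V} | V. vec.subspace V \<and> vec.dim V = 2}"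

text \<open>
  The library types \<open>finite_2\<close> and \<open>finite_3\<close> are instances of class \<open>field\<close> with two and three
  elements respectively, hence serve as the (unique up to isomorphism) fields of these orders.
\<close>

type_synonym F2 = Enum.finite_2
type_synonym F3 = Enum.finite_3

lemma card_F2: "CARD(F2) = 2"
  by (simp add: card_UNIV_length_enum enum_finite_2_def)

lemma card_F3: "CARD(F3) = 3"
  by (simp add: card_UNIV_length_enum enum_finite_3_def)

end

theory Submission
  imports Defs
begin

text \<open>
  Homogeneity is used only through one-point extensions: if two points \<open>p\<close> and \<open>p'\<close> outside a
  finite set \<open>A\<close> lie on the same lines spanned by pairs of points of \<open>A\<close>, then some automorphism
  fixes \<open>A\<close> pointwise and takes \<open>p\<close> to \<open>p'\<close> (\<open>one_point_extension\<close>). Hence all lines have the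
  same size, and if the space is not trivial every line has a third point.

  Two lines then always meet (\<open>lines_meet\<close>). Given a point \<open>a\<close> off a line \<open>l\<close> through \<open>b\<close> and
  \<open>c\<close>, all points \<open>d\<close> off the three sides of the triangle \<open>a, b, c\<close> are conjugate under the
  automorphisms fixing the triangle, and these preserve \<open>l\<close>; since some such \<open>d\<close> is joined to
  \<open>a\<close> by a line meeting \<open>l\<close>, every line through \<open>a\<close> meets \<open>l\<close>. So a homogeneous linear space
  that is neither trivial nor a line is a projective plane, a priori of arbitrary, possibly
  infinite, order.

  The order is bounded by a perspectivity (\<open>line_card_of_quadrangle\<close>). Let lines \<open>l\<close> and \<open>m\<close> cross
  in \<open>e\<close>, let \<open>a, b\<close> be further points of \<open>l\<close> and \<open>c, d\<close> further points of \<open>m\<close>, and let the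
  lines \<open>ac\<close> and \<open>bd\<close> meet in \<open>f\<close>. If \<open>l\<close> has a fourth point \<open>y\<close>, then the projection of \<open>y\<close>
  from \<open>f\<close> to \<open>m\<close> is a fourth point of \<open>m\<close> that is fixed by every automorphism fixing
  \<open>a, b, c, d, e, y\<close>. On the other hand all points of \<open>m\<close> other than \<open>c, d, e\<close> are conjugate
  under these automorphisms, so there is only one. Hence lines have three or four points.

  Finally, a projective plane of order two or three is determined up to isomorphism. Starting from a
  quadrangle, every point and every line can be named, and the names can be read as residues modulo
  7 or 13 in such a way that the lines become the translates of the perfect difference set
  \<open>{0, 1, 3}\<close> or \<open>{0, 1, 3, 9}\<close> (\<open>cyclic_labelling_order_2\<close>, \<open>cyclic_labelling_order_3\<close>). As the
  planes over the fields with two and three elements are projective planes of these orders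
  (\<open>projective_plane_PG2\<close>), they carry the same labellings, and comparing labels gives the
  isomorphism.
\<close>

section \<open>Linear spaces and their automorphisms\<close>

locale linear_space_locale =
  fixes X :: "'a set" and \<L> :: "'a set set"
  assumes linear: "linear_space X \<L>"
begin

lemma point_of_line: "l \<in> \<L> \<Longrightarrow> x \<in> l \<Longrightarrow> x \<in> X"
proof -
  have "\<forall>l\<in>\<L>. l \<subseteq> X" using linear unfolding linear_space_def by simp
  then show "l \<in> \<L> \<Longrightarrow> x \<in> l \<Longrightarrow> x \<in> X" by blast
qed

lemma line_through:
  assumes "x \<in> X" "y \<in> X" "x \<noteq> y"
  obtains l where "l \<in> \<L>" "x \<in> l" "y \<in> l"
proof -
  have "\<exists>!L. L \<in> \<L> \<and> x \<in> L \<and> y \<in> L"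
    using linear assms unfolding linear_space_def by simp
  then show thesis using that by blast
qed

lemma line_unique:
  assumes "l \<in> \<L>" "m \<in> \<L>" "x \<in> l" "y \<in> l" "x \<in> m" "y \<in> m" "x \<noteq> y"
  shows "l = m"
proof -
  have "x \<in> X" "y \<in> X" using assms point_of_line by auto
  then have "\<exists>!L. L \<in> \<L> \<and> x \<in> L \<and> y \<in> L"
    using linear assms(7) unfolding linear_space_def by simp
  then show ?thesis using assms by blast
qed

lemma other_point_on_line:
  assumes "l \<in> \<L>"
  obtains y where "y \<in> l" "y \<noteq> x"
proof -
  have "\<exists>u\<in>l. \<exists>v\<in>l. u \<noteq> v" using linear assms unfolding linear_space_def by simp
  then show thesis using that by blast
qed

lemma collinear_iff_on_line:
  assumes "l \<in> \<L>" "x \<in> l" "y \<in> l" "x \<noteq> y"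
  shows "collinear_in \<L> {x, y, z} \<longleftrightarrow> z \<in> l"
  using assms line_unique[OF assms(1) _ assms(2,3)] unfolding collinear_in_def by blast

lemma point_common_to_lines:
  assumes "l \<in> \<L>" "m \<in> \<L>" "l \<noteq> m" "x \<in> l" "x \<in> m" "y \<in> l" "y \<in> m"
  shows "y = x"
  using assms line_unique by blast

lemma point_off_line:
  assumes "n \<in> \<L>" "m \<in> \<L>" "x \<in> n" "y \<in> n" "x \<in> m" "p \<in> m" "p \<noteq> x" "y \<notin> m"
  shows "p \<notin> n"
  using assms line_unique by blast

lemma collinear_in_subspace:
  assumes "x \<in> Y" "y \<in> Y" "z \<in> Y" "x \<noteq> y"
  shows "collinear_in (subspace_lines \<L> Y) {x, y, z} \<longleftrightarrow> collinear_in \<L> {x, y, z}"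
proof
  assume "collinear_in (subspace_lines \<L> Y) {x, y, z}"
  then show "collinear_in \<L> {x, y, z}"
    unfolding collinear_in_def subspace_lines_def by blast
next
  assume "collinear_in \<L> {x, y, z}"
  then obtain l where l: "l \<in> \<L>" "{x, y, z} \<subseteq> l" unfolding collinear_in_def by blast
  then have "l \<inter> Y \<in> subspace_lines \<L> Y"
    using assms unfolding subspace_lines_def by blast
  moreover have "{x, y, z} \<subseteq> l \<inter> Y" using l assms by simp
  ultimately show "collinear_in (subspace_lines \<L> Y) {x, y, z}"
    unfolding collinear_in_def by blast
qed

text \<open>
  Automorphisms are only required to respect collinearity of triples; that they permute the lines
  follows because a line is recovered from two of its points as the set of points collinear with
  them.
\<close>

lemma automorphism_image_is_line:
  assumes g: "automorphism X \<L> g" and l: "l \<in> \<L>"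
  shows "g ` l \<in> \<L>"
proof -
  obtain x where x: "x \<in> l" using other_point_on_line[OF l] by blast
  obtain y where y: "y \<in> l" "y \<noteq> x" using other_point_on_line[OF l] by blast
  have X: "x \<in> X" "y \<in> X" using point_of_line l x y by auto
  have bij: "bij_betw g X X" and coll: "\<And>z. z \<in> X \<Longrightarrow> z \<noteq> x \<Longrightarrow> z \<noteq> y \<Longrightarrow>
      collinear_in \<L> {x, y, z} \<longleftrightarrow> collinear_in \<L> {g x, g y, g z}"
    using g X y unfolding isomorphism_def embedding_def by auto
  have gX: "g x \<in> X" "g y \<in> X" "g x \<noteq> g y"
    using bij X y(2) by (auto simp: bij_betw_def inj_on_def)
  then obtain m where m: "m \<in> \<L>" "g x \<in> m" "g y \<in> m" using line_through by metis
  have iff: "z \<in> l \<longleftrightarrow> g z \<in> m" if "z \<in> X" for z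
    using coll[OF that] collinear_iff_on_line[OF l x y(1) y(2)[symmetric]]
      collinear_iff_on_line[OF m gX(3)] x y m by (cases "z = x \<or> z = y") auto
  have "m \<subseteq> g ` X" using bij m point_of_line by (auto simp: bij_betw_def)
  then have "g ` l = m" using iff point_of_line[OF l] by blast
  then show ?thesis using m by simp
qed

lemma automorphism_image_line_eq:
  assumes "automorphism X \<L> g" "l \<in> \<L>" "m \<in> \<L>"
    and "x \<in> l" "y \<in> l" "x \<noteq> y" "g x \<in> m" "g y \<in> m"
  shows "g ` l = m"
proof -
  have "x \<in> X" "y \<in> X" using assms point_of_line by auto
  then have "g x \<noteq> g y"
    using assms unfolding isomorphism_def bij_betw_def inj_on_def by metis
  then show ?thesis
    using line_unique[OF automorphism_image_is_line[OF assms(1,2)] assms(3)] assms by blast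
qed

end

section \<open>Homogeneous linear spaces\<close>

locale homogeneous_linear_space = linear_space_locale +
  assumes homogeneous: "homogeneous X \<L>"
begin

text \<open>
  Fixing \<open>A\<close> and exchanging \<open>p\<close> for \<open>p'\<close> is an isomorphism of finite subspaces, because the
  collinear triples that involve the new point are exactly those prescribed by the lines through two
  points of \<open>A\<close>.
\<close>

lemma one_point_extension:
  assumes A: "finite A" "A \<subseteq> X" and p: "p \<in> X - A" "p' \<in> X - A"
    and same: "\<And>l u v. l \<in> \<L> \<Longrightarrow> u \<in> A \<Longrightarrow> v \<in> A \<Longrightarrow> u \<noteq> v \<Longrightarrow> u \<in> l \<Longrightarrow> v \<in> l \<Longrightarrow>
      p \<in> l \<longleftrightarrow> p' \<in> l"
  obtains g where "automorphism X \<L> g" "\<And>a. a \<in> A \<Longrightarrow> g a = a" "g p = p'"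
proof -
  define f where "f = id(p := p')"
  let ?B = "insert p A" and ?C = "insert p' A"
  have f [simp]: "f p = p'" "\<And>a. a \<in> A \<Longrightarrow> f a = a"
    using p by (auto simp: f_def)
  have bij: "bij_betw f ?B ?C"
    using p by (auto simp: bij_betw_def inj_on_def f_def)
  have same': "collinear_in \<L> {u, v, p} \<longleftrightarrow> collinear_in \<L> {u, v, p'}"
    if uv: "u \<in> A" "v \<in> A" "u \<noteq> v" for u v
  proof -
    have "u \<in> X" "v \<in> X" using uv A by auto
    then obtain l where "l \<in> \<L>" "u \<in> l" "v \<in> l" using line_through uv by metis
    then show ?thesis using same[of l u v] uv collinear_iff_on_line[of l u v] by simp
  qed
  have "collinear_in (subspace_lines \<L> ?B) {x, y, z} \<longleftrightarrow>
      collinear_in (subspace_lines \<L> ?C) {f x, f y, f z}"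
    if xyz: "x \<in> ?B" "y \<in> ?B" "z \<in> ?B" "x \<noteq> y" "y \<noteq> z" "x \<noteq> z" for x y z
  proof -
    have "f x \<in> ?C" "f y \<in> ?C" "f z \<in> ?C" "f x \<noteq> f y"
      using xyz bij_betw_apply[OF bij] bij_betw_imp_inj_on[OF bij, THEN inj_onD, of x y] by blast+
    moreover have "collinear_in \<L> {x, y, z} \<longleftrightarrow> collinear_in \<L> {f x, f y, f z}"
    proof -
      consider "x = p" "y \<in> A" "z \<in> A" | "y = p" "x \<in> A" "z \<in> A"
        | "z = p" "x \<in> A" "y \<in> A" | "x \<in> A" "y \<in> A" "z \<in> A"
        using xyz by blast
      then show ?thesis
      proof cases
        case 1 then show ?thesis using same'[of y z] xyz by (simp add: insert_commute)
      next
        case 2 then show ?thesis using same'[of x z] xyz by (simp add: insert_commute)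
      next
        case 3 then show ?thesis using same'[of x y] xyz by simp
      qed simp
    qed
    ultimately show ?thesis using collinear_in_subspace xyz by simp
  qed
  then have "isomorphism ?B (subspace_lines \<L> ?B) ?C (subspace_lines \<L> ?C) f"
    using bij unfolding isomorphism_def embedding_def by (auto simp: bij_betw_def)
  moreover have "?B \<subseteq> X" "?C \<subseteq> X" "finite ?B" "finite ?C" using A p by auto
  ultimately have "\<exists>g. automorphism X \<L> g \<and> (\<forall>a\<in>?B. g a = f a)"
    by (intro homogeneous[unfolded homogeneous_def, rule_format, of ?B ?C f] conjI)
  then obtain g where "automorphism X \<L> g" "\<forall>a\<in>?B. g a = f a" by blast
  then show thesis using that[of g] by simp
qed

text \<open>
  Two lines through \<open>x\<close> are conjugate since any two points different from \<open>x\<close> are conjugate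
  over \<open>{x}\<close>; lines without a common point are compared through a transversal. An infinite
  line has cardinality 0 here, so in particular no infinite line coexists with a finite one.
\<close>

lemma card_lines_eq:
  assumes lm: "l \<in> \<L>" "m \<in> \<L>"
  shows "card l = card m"
proof -
  have meeting: "card l = card m" if lmx: "l \<in> \<L>" "m \<in> \<L>" "x \<in> l" "x \<in> m" for l m x
  proof -
    obtain y where y: "y \<in> l" "y \<noteq> x" using other_point_on_line lmx by metis
    obtain y' where y': "y' \<in> m" "y' \<noteq> x" using other_point_on_line lmx by metis
    obtain g where g: "automorphism X \<L> g" "g x = x" "g y = y'"
      using one_point_extension[of "{x}" y y'] y y' lmx point_of_line by auto
    have "g ` l = m"
      using automorphism_image_line_eq[OF g(1) lmx(1,2) lmx(3) y(1)] g y y' lmx by simp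
    moreover have "inj_on g l"
    proof (rule inj_on_subset)
      show "inj_on g X" using g(1) unfolding isomorphism_def embedding_def by simp
      show "l \<subseteq> X" using lmx(1) point_of_line by blast
    qed
    ultimately show ?thesis using card_image[of g l] by simp
  qed
  obtain x where x: "x \<in> l" using other_point_on_line lm by metis
  obtain y where y: "y \<in> m" "y \<noteq> x" using other_point_on_line lm by metis
  obtain n where "n \<in> \<L>" "x \<in> n" "y \<in> n"
    using line_through[of x y] x y lm point_of_line by metis
  then show ?thesis using meeting[of l n x] meeting[of n m y] lm x y by simp
qed

text \<open>
  It suffices to treat a line \<open>m\<close> through a point \<open>a\<close> off \<open>l\<close>. One line through \<open>a\<close>, different
  from two sides of a triangle with base on \<open>l\<close>, meets \<open>l\<close> by construction; an automorphism
  fixing the triangle takes it to \<open>m\<close>.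
\<close>

lemma lines_meet:
  assumes third: "\<And>l x y. l \<in> \<L> \<Longrightarrow> \<exists>z\<in>l. z \<noteq> x \<and> z \<noteq> y"
    and lm: "l \<in> \<L>" "m \<in> \<L>"
  shows "l \<inter> m \<noteq> {}"
proof -
  obtain a where a: "a \<in> m" using other_point_on_line lm by metis
  show ?thesis
  proof (cases "a \<in> l")
    case False
    obtain b where b: "b \<in> l" using third lm by blast
    obtain c where c: "c \<in> l" "c \<noteq> b" using third lm by blast
    obtain e where e: "e \<in> l" "e \<noteq> b" "e \<noteq> c" using third lm by blast
    have X: "a \<in> X" "b \<in> X" "c \<in> X" "e \<in> X" using a b c e lm point_of_line by auto
    have ne: "a \<noteq> b" "a \<noteq> c" "a \<noteq> e" using False b c e by auto
    obtain ab where ab: "ab \<in> \<L>" "a \<in> ab" "b \<in> ab" using line_through X ne by metis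
    obtain ac where ac: "ac \<in> \<L>" "a \<in> ac" "c \<in> ac" using line_through X ne by metis
    obtain n where n: "n \<in> \<L>" "a \<in> n" "e \<in> n" using line_through X ne by metis
    obtain d where d: "d \<in> n" "d \<noteq> a" "d \<noteq> e" using third n by blast
    have dl: "d \<notin> ab" "d \<notin> ac" "d \<notin> l"
      using ab ac n d e b c lm line_unique False by metis+
    show ?thesis
    proof (cases "m = ab \<or> m = ac")
      case True
      then show ?thesis using ab ac b c by blast
    next
      case m: False
      obtain d' where d': "d' \<in> m" "d' \<noteq> a" using other_point_on_line lm by metis
      have dl': "d' \<notin> ab" "d' \<notin> ac" using m d' a ab ac lm line_unique by metis+
      show ?thesis
      proof (cases "d' \<in> l")
        case d'l: False
        \<comment> \<open>Now \<open>d\<close> and \<open>d'\<close> both complete \<open>a, b, c\<close> to four points with no three collinear.\<close>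
        \<comment> \<open>Hence they are conjugate over \<open>{a, b, c}\<close>, which carries \<open>n\<close> to \<open>m\<close> and \<open>l\<close> to itself.\<close>
        have "d \<in> n" "d' \<in> X" "d \<in> X" using d d' lm n point_of_line by auto
        moreover have "d \<in> k \<longleftrightarrow> d' \<in> k"
          if "k \<in> \<L>" "u \<in> {a, b, c}" "v \<in> {a, b, c}" "u \<noteq> v" "u \<in> k" "v \<in> k" for k u v
        proof -
          have "k = ab \<or> k = ac \<or> k = l"
            using that ab ac b c lm line_unique[OF that(1)] by (elim insertE emptyE) blast+
          then show ?thesis using dl dl' d'l by auto
        qed
        moreover have "d \<notin> {a, b, c}" "d' \<notin> {a, b, c}" using dl dl' ab ac by blast+
        ultimately obtain g where g: "automorphism X \<L> g" "\<And>x. x \<in> {a, b, c} \<Longrightarrow> g x = x" "g d = d'"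
          using one_point_extension[of "{a, b, c}" d d'] X by blast
        have "g ` n = m" using automorphism_image_line_eq[OF g(1) n(1) lm(2) n(2) d(1)] g d a d' by simp
        moreover have "g ` l = l"
          using automorphism_image_line_eq[OF g(1) lm(1) lm(1) b c(1)] g b c by simp
        ultimately show ?thesis using n e by blast
      qed (use d' in blast)
    qed
  qed (use a in blast)
qed

text \<open>
  With \<open>f\<close> the intersection of \<open>ac\<close> and \<open>bd\<close>, the perspectivity with centre \<open>f\<close> takes
  \<open>a, b, e\<close> on \<open>l\<close> to \<open>c, d, e\<close> on \<open>m\<close>, so it takes a fourth point \<open>y\<close> of \<open>l\<close> to a fourth
  point \<open>z\<close> of \<open>m\<close>. The point \<open>z\<close> is constructed from \<open>a, b, c, d, e, y\<close>, whereas
  collinearity alone does not distinguish it, over these six points, from any other point of \<open>m\<close>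
  outside \<open>{c, d, e}\<close>.
\<close>

lemma line_card_of_quadrangle:
  assumes meet: "\<And>l m. l \<in> \<L> \<Longrightarrow> m \<in> \<L> \<Longrightarrow> l \<inter> m \<noteq> {}"
    and lm: "l \<in> \<L>" "m \<in> \<L>" "l \<noteq> m"
    and l: "a \<in> l" "b \<in> l" "e \<in> l" "a \<noteq> b" "a \<noteq> e" "b \<noteq> e"
    and m: "c \<in> m" "d \<in> m" "e \<in> m" "c \<noteq> d" "c \<noteq> e" "d \<noteq> e"
  shows "card l = 3 \<or> card m = 4"
proof (cases "l = {a, b, e}")
  case False
  then obtain y where y: "y \<in> l" "y \<notin> {a, b, e}" using l by blast
  have X: "a \<in> X" "b \<in> X" "c \<in> X" "d \<in> X" "e \<in> X" "y \<in> X"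
    using l m y lm point_of_line by auto
  have lm_e: "x = e" if "x \<in> l" "x \<in> m" for x
    using point_common_to_lines[OF lm l(3) m(3) that] .
  have off: "a \<notin> m" "b \<notin> m" "y \<notin> m" "c \<notin> l" "d \<notin> l" using lm_e l m y by blast+
  obtain ac where ac: "ac \<in> \<L>" "a \<in> ac" "c \<in> ac" using line_through X off m by metis
  obtain bd where bd: "bd \<in> \<L>" "b \<in> bd" "d \<in> bd" using line_through X off m by metis
  have ne: "ac \<noteq> l" "ac \<noteq> m" "bd \<noteq> l" "bd \<noteq> m" using ac bd off by blast+
  have ac_l: "x = a" if "x \<in> ac" "x \<in> l" for x
    using point_common_to_lines[OF ac(1) lm(1) ne(1) ac(2) l(1) that] .
  have ac_m: "x = c" if "x \<in> ac" "x \<in> m" for x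
    using point_common_to_lines[OF ac(1) lm(2) ne(2) ac(3) m(1) that] .
  have bd_l: "x = b" if "x \<in> bd" "x \<in> l" for x
    using point_common_to_lines[OF bd(1) lm(1) ne(3) bd(2) l(2) that] .
  have bd_m: "x = d" if "x \<in> bd" "x \<in> m" for x
    using point_common_to_lines[OF bd(1) lm(2) ne(4) bd(3) m(2) that] .
  obtain f where f: "f \<in> ac" "f \<in> bd" using meet ac bd by blast
  have fl: "f \<notin> l" "f \<notin> m" using f ac_l ac_m bd_l bd_m l m by metis+
  have "ac \<noteq> bd" using ac_l ac(2) bd_l l by metis
  then have ac_bd: "x = f" if "x \<in> ac" "x \<in> bd" for x
    using point_common_to_lines[OF ac(1) bd(1) _ f that] by simp
  have f_ne: "f \<in> X" "f \<noteq> y" using f ac point_of_line fl y by blast+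
  then obtain k where k: "k \<in> \<L>" "f \<in> k" "y \<in> k" using line_through X by metis
  obtain z where z: "z \<in> k" "z \<in> m" using meet k lm by blast
  have k_ne: "k \<noteq> m" "k \<noteq> l" "k \<noteq> ac" "k \<noteq> bd"
    using k fl ac_l bd_l y by blast+
  have k_m: "x = z" if "x \<in> k" "x \<in> m" for x
    using point_common_to_lines[OF k(1) lm(2) k_ne(1) z that] .
  have z_ne: "z \<noteq> c" "z \<noteq> d" "z \<noteq> e"
  proof -
    show "z \<noteq> e" using point_common_to_lines[OF k(1) lm(1) k_ne(2) k(3) y(1) z(1)] y l by blast
    show "z \<noteq> c" using point_common_to_lines[OF k(1) ac(1) k_ne(3) k(2) f(1) z(1)] ac fl m by blast
    show "z \<noteq> d" using point_common_to_lines[OF k(1) bd(1) k_ne(4) k(2) f(2) z(1)] bd fl m by blast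
  qed
  have uniq: "w = z" if w: "w \<in> m" "w \<notin> {c, d, e}" for w
  proof -
    let ?A = "{a, b, e, y, c, d}"
    \<comment> \<open>The lines meeting the configuration in two points and \<open>m\<close> in a further point are \<open>m\<close> alone.\<close>
    have on_m: "x \<in> n \<longleftrightarrow> n = m"
      if x: "x \<in> m" "x \<notin> {c, d, e}"
        and n: "n \<in> \<L>" "u \<in> ?A" "v \<in> ?A" "u \<noteq> v" "u \<in> n" "v \<in> n" for x n u v
    proof
      assume xn: "x \<in> n"
      show "n = m"
      proof (rule ccontr)
        assume nm: "n \<noteq> m"
        have "q = x" if "q \<in> n" "q \<in> m" for q
          using point_common_to_lines[OF n(1) lm(2) nm xn x(1) that] .
        then have "u \<notin> {c, d, e}" "v \<notin> {c, d, e}" using x(2) n m by blast+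
        then have "u \<in> l" "v \<in> l" using n l y by blast+
        then have "n = l" using line_unique[OF n(1) lm(1) n(5,6)] n(4) by blast
        then show False using xn lm_e x by blast
      qed
    qed (use x in blast)
    have "w \<in> X" "z \<in> X" using w z lm point_of_line by blast+
    moreover have "w \<notin> ?A" "z \<notin> ?A" using w z off z_ne by blast+
    moreover have "z \<in> n \<longleftrightarrow> w \<in> n"
      if n: "n \<in> \<L>" "u \<in> ?A" "v \<in> ?A" "u \<noteq> v" "u \<in> n" "v \<in> n" for n u v
      using on_m[OF w n] on_m[OF z(2) _ n] z_ne by simp
    ultimately obtain g where g: "automorphism X \<L> g" "\<And>x. x \<in> ?A \<Longrightarrow> g x = x" "g z = w"
      using one_point_extension[of ?A z w] X by simp blast
    have fixed: "g a = a" "g b = b" "g c = c" "g d = d" "g e = e" "g y = y"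
      using g(2) by blast+
    have "a \<noteq> c" "b \<noteq> d" using off l m by blast+
    then have "g ` ac = ac" "g ` bd = bd"
      using automorphism_image_line_eq[OF g(1) ac(1) ac(1) ac(2,3)]
        automorphism_image_line_eq[OF g(1) bd(1) bd(1) bd(2,3)] fixed ac bd by simp_all
    then have "g f = f" using f ac_bd by blast
    then have "g ` k = k"
      using automorphism_image_line_eq[OF g(1) k(1) k(1) k(2,3)] fixed k f_ne by simp
    then have "w \<in> k" using g z by blast
    then show ?thesis using k_m w by blast
  qed
  have "m = {c, d, e, z}" using uniq m z by blast
  then show ?thesis using m z_ne by simp
next
  case True
  then show ?thesis using l by simp
qed

end

section \<open>Cyclic labellings\<close>

text \<open>
  A labelling identifies the points with the residues modulo \<open>n\<close> and sends each translate of
  \<open>S\<close> to a line. Nothing is said about further lines: when any two residues lie in a common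
  translate, every line is one of these.
\<close>

definition cyclic_labelling :: "'a set \<Rightarrow> 'a set set \<Rightarrow> nat \<Rightarrow> nat set \<Rightarrow> (nat \<Rightarrow> 'a) \<Rightarrow> bool" where
  "cyclic_labelling X \<L> n S p \<longleftrightarrow>
     bij_betw p {..<n} X \<and> (\<forall>i<n. (\<lambda>s. p ((i + s) mod n)) ` S \<in> \<L>)"

text \<open>
  Since any two residues lie in a common translate, the line through two labelled points is the
  image of that translate. So collinearity can be read off the labels, whatever the space is.
\<close>

lemma collinear_cyclic_labelling:
  assumes X: "linear_space X \<L>" and p: "cyclic_labelling X \<L> n S p"
    and covers: "\<And>i j. i < n \<Longrightarrow> j < n \<Longrightarrow> \<exists>t<n. {i, j} \<subseteq> (\<lambda>s. (t + s) mod n) ` S"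
    and ijk: "i < n" "j < n" "k < n" "i \<noteq> j"
  shows "collinear_in \<L> {p i, p j, p k} \<longleftrightarrow> (\<exists>t<n. {i, j, k} \<subseteq> (\<lambda>s. (t + s) mod n) ` S)"
proof -
  interpret linear_space_locale X \<L> using X by unfold_locales
  let ?T = "\<lambda>t. (\<lambda>s. (t + s) mod n) ` S"
  have inj: "inj_on p {..<n}" using p by (simp add: cyclic_labelling_def bij_betw_def)
  have line: "p ` ?T t \<in> \<L>" if "t < n" for t
    using p that by (simp add: cyclic_labelling_def image_image)
  have "p i \<noteq> p j" using inj ijk by (auto dest: inj_onD)
  have mem: "p r \<in> p ` ?T t \<longleftrightarrow> r \<in> ?T t" if "r < n" for r t
  proof (rule inj_on_image_mem_iff[OF inj])
    show "?T t \<subseteq> {..<n}" using that by (simp add: image_subset_iff)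
  qed (use that in simp)
  have iff: "collinear_in \<L> {p i, p j, p k} \<longleftrightarrow> k \<in> ?T t" if "t < n" "{i, j} \<subseteq> ?T t" for t
    using collinear_iff_on_line[OF line[OF that(1)], of "p i" "p j" "p k"] that(2)
      \<open>p i \<noteq> p j\<close> mem[OF ijk(3)] by simp
  show ?thesis using covers[OF ijk(1,2)] iff by blast
qed

lemma isomorphic_of_cyclic_labellings:
  assumes XY: "linear_space X \<L>" "linear_space Y \<M>"
    and p: "cyclic_labelling X \<L> n S p" and r: "cyclic_labelling Y \<M> n S r"
    and covers: "\<And>i j. i < n \<Longrightarrow> j < n \<Longrightarrow> \<exists>t<n. {i, j} \<subseteq> (\<lambda>s. (t + s) mod n) ` S"
  shows "isomorphic_spaces X \<L> Y \<M>"
proof -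
  have bij: "bij_betw p {..<n} X" "bij_betw r {..<n} Y"
    using p r by (simp_all add: cyclic_labelling_def)
  define h where "h = inv_into {..<n} p"
  have h: "h x < n" "p (h x) = x" if "x \<in> X" for x
    using bij_betw_inv_into_right[OF bij(1) that] bij_betw_apply[OF bij_betw_inv_into[OF bij(1)] that]
    by (simp_all add: h_def)
  have hr: "bij_betw (r \<circ> h) X Y"
    unfolding h_def using bij_betw_trans[OF bij_betw_inv_into[OF bij(1)] bij(2)] .
  have "collinear_in \<L> {x, y, z} \<longleftrightarrow> collinear_in \<M> {(r \<circ> h) x, (r \<circ> h) y, (r \<circ> h) z}"
    if xyz: "x \<in> X" "y \<in> X" "z \<in> X" "x \<noteq> y" for x y z
  proof -
    have "h x \<noteq> h y" using h(2)[OF xyz(1)] h(2)[OF xyz(2)] xyz(4) by metis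
    then show ?thesis
      using collinear_cyclic_labelling[OF XY(1) p covers, of "h x" "h y" "h z"]
        collinear_cyclic_labelling[OF XY(2) r covers, of "h x" "h y" "h z"] h xyz by simp
  qed
  then have "isomorphism X \<L> Y \<M> (r \<circ> h)"
    using hr unfolding isomorphism_def embedding_def by (simp add: bij_betw_def)
  then show ?thesis unfolding isomorphic_spaces_def by blast
qed

lemma difference_set_7:
  assumes "i < 7" "j < 7"
  shows "\<exists>t<7. {i, j} \<subseteq> (\<lambda>s. (t + s) mod 7) ` {0, 1, 3 :: nat}"
proof -
  have "\<forall>i\<in>{..<7}. \<forall>j\<in>{..<7}. \<exists>t\<in>{..<7}. {i, j} \<subseteq> (\<lambda>s. (t + s) mod 7) ` {0, 1, 3 :: nat}"
    by (simp add: lessThan_nat_numeral lessThan_Suc)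
  then show ?thesis using assms by blast
qed

lemma difference_set_13:
  assumes "i < 13" "j < 13"
  shows "\<exists>t<13. {i, j} \<subseteq> (\<lambda>s. (t + s) mod 13) ` {0, 1, 3, 9 :: nat}"
proof -
  have "\<forall>i\<in>{..<13}. \<forall>j\<in>{..<13}. \<exists>t\<in>{..<13}. {i, j} \<subseteq> (\<lambda>s. (t + s) mod 13) ` {0, 1, 3, 9 :: nat}"
    by (simp add: lessThan_nat_numeral lessThan_Suc)
  then show ?thesis using assms by blast
qed

section \<open>Projective planes of order two and three\<close>

text \<open>The parameter \<open>k\<close> is the number of points on a line, one more than the order of the plane.\<close>

locale projective_plane_locale = linear_space_locale +
  fixes k :: nat
  assumes lines_meet: "l \<in> \<L> \<Longrightarrow> m \<in> \<L> \<Longrightarrow> l \<inter> m \<noteq> {}"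
    and line_card: "l \<in> \<L> \<Longrightarrow> card l = k"
    and two_lines: "\<exists>l\<in>\<L>. \<exists>m\<in>\<L>. l \<noteq> m"

lemma card_4_fourth_point:
  assumes "card l = 4" "{x, y, z} \<subseteq> l" "distinct [x, y, z]"
  obtains w where "l = {x, y, z, w}" "distinct [x, y, z, w]"
proof -
  have "card (l - {x, y, z}) = 1" using assms by (simp add: card_Diff_subset)
  then obtain w where "l - {x, y, z} = {w}" by (rule card_1_singletonE)
  then show thesis using that[of w] assms(2,3) by auto
qed

context projective_plane_locale
begin

text \<open>
  The four points \<open>a, b, c, d\<close> found here form a quadrangle with diagonal point \<open>e\<close>.
\<close>

lemma two_lines_with_points:
  assumes "k \<ge> 3"
  obtains l m a b c d e where "l \<in> \<L>" "m \<in> \<L>" "l \<noteq> m" "{a, b, e} \<subseteq> l" "{c, d, e} \<subseteq> m"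
    "distinct [a, b, c, d, e]" "a \<notin> m" "b \<notin> m" "c \<notin> l" "d \<notin> l"
proof -
  obtain l m where lm: "l \<in> \<L>" "m \<in> \<L>" "l \<noteq> m" using two_lines by blast
  obtain e where e: "e \<in> l" "e \<in> m" using lines_meet lm by blast
  have two: "\<exists>x y. x \<in> n \<and> y \<in> n \<and> x \<noteq> y \<and> x \<noteq> e \<and> y \<noteq> e" if "n \<in> \<L>" "e \<in> n" for n
  proof -
    have "card (n - {e}) \<ge> 2" using line_card[OF that(1)] that(2) assms by simp
    then obtain U where "U \<subseteq> n - {e}" "card U = 2" by (meson obtain_subset_with_card_n)
    then obtain x y where "{x, y} \<subseteq> n - {e}" "x \<noteq> y" by (auto simp: card_2_iff)
    then show ?thesis by blast
  qed
  obtain a b where ab: "a \<in> l" "b \<in> l" "a \<noteq> b" "a \<noteq> e" "b \<noteq> e" using two lm e by blast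
  obtain c d where cd: "c \<in> m" "d \<in> m" "c \<noteq> d" "c \<noteq> e" "d \<noteq> e" using two lm e by blast
  have "x = e" if "x \<in> l" "x \<in> m" for x using point_common_to_lines[OF lm e that] .
  then have "a \<notin> m" "b \<notin> m" "c \<notin> l" "d \<notin> l" using ab cd by blast+
  then show thesis using that[OF lm, of a b e c d] ab cd e by auto
qed

text \<open>
  The complete quadrangle: four points, no three of them collinear, their six joining lines and the
  three diagonal points \<open>e, f, g\<close>. In planes of order two and three it generates all points.
\<close>

lemma quadrangle:
  assumes "k \<ge> 3"
  obtains a b c d e f g ab cd ac bd ad bc where
    "ab \<in> \<L>" "cd \<in> \<L>" "ac \<in> \<L>" "bd \<in> \<L>" "ad \<in> \<L>" "bc \<in> \<L>"
    "{a, b, e} \<subseteq> ab" "{c, d, e} \<subseteq> cd" "{a, c, f} \<subseteq> ac" "{b, d, f} \<subseteq> bd"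
    "{a, d, g} \<subseteq> ad" "{b, c, g} \<subseteq> bc"
    "distinct [a, b, c, d, e, f, g]" "distinct [ab, cd, ac, bd, ad, bc]"
proof -
  obtain l m a b c d e where lm: "l \<in> \<L>" "m \<in> \<L>" "l \<noteq> m" "{a, b, e} \<subseteq> l" "{c, d, e} \<subseteq> m"
    and dist: "distinct [a, b, c, d, e]" and off: "a \<notin> m" "b \<notin> m" "c \<notin> l" "d \<notin> l"
    by (rule two_lines_with_points[OF assms])
  have X: "a \<in> X" "b \<in> X" "c \<in> X" "d \<in> X" "e \<in> X" using lm point_of_line by blast+
  have abcde: "a \<in> l" "b \<in> l" "e \<in> l" "c \<in> m" "d \<in> m" "e \<in> m" using lm by blast+
  have ne: "a \<noteq> b" "a \<noteq> c" "a \<noteq> d" "a \<noteq> e" "b \<noteq> c" "b \<noteq> d" "b \<noteq> e" "c \<noteq> d" "c \<noteq> e" "d \<noteq> e"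
    using dist by simp_all
  obtain ac where ac: "ac \<in> \<L>" "a \<in> ac" "c \<in> ac" using line_through[OF X(1,3) ne(2)] .
  obtain bd where bd: "bd \<in> \<L>" "b \<in> bd" "d \<in> bd" using line_through[OF X(2,4) ne(6)] .
  obtain ad where ad: "ad \<in> \<L>" "a \<in> ad" "d \<in> ad" using line_through[OF X(1,4) ne(3)] .
  obtain bc where bc: "bc \<in> \<L>" "b \<in> bc" "c \<in> bc" using line_through[OF X(2,3) ne(5)] .
  have off_ac: "b \<notin> ac" "e \<notin> ac" "d \<notin> ac"
    using point_off_line[OF ac(1) lm(1) ac(2,3) abcde(1)]
      point_off_line[OF ac(1) lm(2) ac(3,2) abcde(4)] off abcde ne by metis+
  have off_bd: "a \<notin> bd" "e \<notin> bd" "c \<notin> bd"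
    using point_off_line[OF bd(1) lm(1) bd(2,3) abcde(2)]
      point_off_line[OF bd(1) lm(2) bd(3,2) abcde(5)] off abcde ne by metis+
  have off_ad: "b \<notin> ad" "e \<notin> ad" "c \<notin> ad"
    using point_off_line[OF ad(1) lm(1) ad(2,3) abcde(1)]
      point_off_line[OF ad(1) lm(2) ad(3,2) abcde(5)] off abcde ne by metis+
  have off_bc: "a \<notin> bc" "e \<notin> bc" "d \<notin> bc"
    using point_off_line[OF bc(1) lm(1) bc(2,3) abcde(2)]
      point_off_line[OF bc(1) lm(2) bc(3,2) abcde(4)] off abcde ne by metis+
  obtain f where f: "f \<in> ac" "f \<in> bd" using lines_meet[OF ac(1) bd(1)] by blast
  obtain g where g: "g \<in> ad" "g \<in> bc" using lines_meet[OF ad(1) bc(1)] by blast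
  have lines: "distinct [l, m, ac, bd, ad, bc]"
    using lm(3) abcde off ac bd ad bc off_ac off_bd off_ad off_bc by auto
  have "f \<noteq> a" "f \<noteq> b" "f \<noteq> c" "f \<noteq> d" "f \<noteq> e" using f off_ac off_bd by metis+
  moreover have "g \<noteq> a" "g \<noteq> b" "g \<noteq> c" "g \<noteq> d" "g \<noteq> e" using g off_ad off_bc by metis+
  moreover have "f \<noteq> g"
  proof
    have "ac \<noteq> ad" using lines by simp
    moreover assume "f = g"
    ultimately have "f = a"
      using point_common_to_lines[OF ac(1) ad(1) _ ac(2) ad(2) f(1)] g(1) by simp
    with \<open>f \<noteq> a\<close> show False by simp
  qed
  ultimately have "distinct [a, b, c, d, e, f, g]" using dist by auto
  then show thesis
    using that[OF lm(1,2) ac(1) bd(1) ad(1) bc(1) lm(4,5)] lines ac bd ad bc f g by blast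
qed

text \<open>
  The sides of the quadrangle are full lines already. The seventh line joins the diagonal points:
  the line \<open>eg\<close> must meet the side \<open>ac\<close>, and only \<open>f\<close> is left for that. There are no other points,
  because every line through \<open>a\<close> meets \<open>bc\<close> and so is one of the three sides at \<open>a\<close>.
\<close>

lemma cyclic_labelling_order_2:
  assumes k: "k = 3"
  obtains p where "cyclic_labelling X \<L> 7 {0, 1, 3} p"
proof -
  have "k \<ge> 3" using k by simp
  then obtain a b c d e f g ab cd ac bd ad bc where
    lines: "ab \<in> \<L>" "cd \<in> \<L>" "ac \<in> \<L>" "bd \<in> \<L>" "ad \<in> \<L>" "bc \<in> \<L>" and
    sub: "{a, b, e} \<subseteq> ab" "{c, d, e} \<subseteq> cd" "{a, c, f} \<subseteq> ac" "{b, d, f} \<subseteq> bd"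
      "{a, d, g} \<subseteq> ad" "{b, c, g} \<subseteq> bc" and
    dist: "distinct [a, b, c, d, e, f, g]"
    by (rule quadrangle)
  have triple: "l = {x, y, z}" if "l \<in> \<L>" "{x, y, z} \<subseteq> l" "distinct [x, y, z]" for l x y z
  proof -
    have "finite l" using line_card[OF that(1)] k card_ge_0_finite by force
    then show ?thesis using card_subset_eq[OF _ that(2)] line_card[OF that(1)] k that(3) by simp
  qed
  have ab: "ab = {a, b, e}" and cd: "cd = {c, d, e}" and ac: "ac = {a, c, f}"
    and bd: "bd = {b, d, f}" and ad: "ad = {a, d, g}" and bc: "bc = {b, c, g}"
    using triple[OF lines(1) sub(1)] triple[OF lines(2) sub(2)] triple[OF lines(3) sub(3)]
      triple[OF lines(4) sub(4)] triple[OF lines(5) sub(5)] triple[OF lines(6) sub(6)] dist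
    by simp_all
  have X: "{a, b, c, d, e, f, g} \<subseteq> X"
    using point_of_line[OF lines(1)] point_of_line[OF lines(2)] point_of_line[OF lines(3)]
      point_of_line[OF lines(5)] unfolding ab cd ac ad by simp
  obtain n where n: "n \<in> \<L>" "e \<in> n" "g \<in> n" using line_through[of e g] X dist by auto
  have "a \<notin> n" using point_off_line[OF n(1) lines(1) n(2,3), of a] ab dist by auto
  moreover have "c \<notin> n" using point_off_line[OF n(1) lines(2) n(2,3), of c] cd dist by auto
  ultimately have "f \<in> n" using lines_meet[OF n(1) lines(3)] ac by blast
  then have efg: "n = {e, f, g}" using triple[OF n(1), of e f g] n dist by auto
  have "z \<in> {a, b, c, d, e, f, g}" if z: "z \<in> X" for z
  proof (cases "z = a")
    case False
    obtain r where r: "r \<in> \<L>" "a \<in> r" "z \<in> r"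
      using line_through[of a z] X z False by auto
    obtain w where w: "w \<in> r" "w \<in> {b, c, g}" using lines_meet[OF r(1) lines(6)] bc by blast
    have "r = ab \<or> r = ac \<or> r = ad"
      using line_unique[OF r(1) lines(1) r(2) w(1)] line_unique[OF r(1) lines(3) r(2) w(1)]
        line_unique[OF r(1) lines(5) r(2) w(1)] w(2) ab ac ad dist by auto
    then show ?thesis using r(3) ab ac ad by blast
  qed simp
  then have carrier: "X = {a, b, c, d, e, f, g}" using X by blast
  \<comment> \<open>Residues 0 to 6 in this order turn the seven lines into the translates of \<open>{0, 1, 3}\<close>.\<close>
  define xs where "xs = [a, b, c, e, g, d, f]"
  have "bij_betw ((!) xs) {..<7} X"
    by (rule bij_betw_nth) (use dist in \<open>auto simp: xs_def carrier\<close>)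
  moreover have "(\<lambda>s. xs ! ((i + s) mod 7)) ` {0, 1, 3} \<in> \<L>" if "i < 7" for i
  proof -
    have "{a, b, e} \<in> \<L>" "{b, c, g} \<in> \<L>" "{c, e, d} \<in> \<L>" "{e, g, f} \<in> \<L>"
      "{g, d, a} \<in> \<L>" "{d, f, b} \<in> \<L>" "{f, a, c} \<in> \<L>"
      using lines n(1) unfolding ab cd ac bd ad bc efg by (simp_all add: insert_commute)
    moreover have "i \<in> {0, 1, 2, 3, 4, 5, 6}" using that by auto
    ultimately show ?thesis by (auto simp: xs_def)
  qed
  ultimately have "cyclic_labelling X \<L> 7 {0, 1, 3} ((!) xs)"
    unfolding cyclic_labelling_def by blast
  then show thesis by (rule that)
qed

text \<open>
  All the points to be named in a plane of order three lie on the sides of a quadrangle, and this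
  lemma separates the points of different sides.
\<close>

lemma distinct_of_crossing_lines:
  assumes "l \<in> \<L>" "m \<in> \<L>" "l \<noteq> m"
    and "{x, p, q, r} \<subseteq> l" "{x, p', q', r'} \<subseteq> m"
    and "distinct [x, p, q, r]" "distinct [x, p', q', r']"
  shows "distinct [p, q, r, p', q', r']"
proof -
  have "\<forall>y\<in>l. y \<noteq> x \<longrightarrow> y \<notin> m"
    using point_common_to_lines[OF assms(1-3)] assms(4,5) by simp blast
  then have "\<forall>y\<in>{p, q, r}. y \<notin> m"
    using assms(4,6) by auto
  then have "{p, q, r} \<inter> {p', q', r'} = {}" using assms(5) by blast
  then show ?thesis using assms(6,7) by auto
qed

text \<open>
  Each side of the quadrangle has one point besides its two vertices and its diagonal point; these
  six points \<open>h, i, j, u, v, w\<close> together with the vertices and diagonal points make thirteen. The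
  other seven lines, each named after its four points, are forced: take the line through two of the
  points, let it meet a known line, and exclude three of the four possible intersections because they
  would put both chosen points on another known line.
\<close>

lemma cyclic_labelling_order_3:
  assumes k: "k = 4"
  obtains p where "cyclic_labelling X \<L> 13 {0, 1, 3, 9} p"
proof -
  have "k \<ge> 3" using k by simp
  then obtain a b c d e f g ab cd ac bd ad bc where
    lines: "ab \<in> \<L>" "cd \<in> \<L>" "ac \<in> \<L>" "bd \<in> \<L>" "ad \<in> \<L>" "bc \<in> \<L>" and
    sub: "{a, b, e} \<subseteq> ab" "{c, d, e} \<subseteq> cd" "{a, c, f} \<subseteq> ac" "{b, d, f} \<subseteq> bd"
      "{a, d, g} \<subseteq> ad" "{b, c, g} \<subseteq> bc" and
    dist: "distinct [a, b, c, d, e, f, g]" and dist_lines: "distinct [ab, cd, ac, bd, ad, bc]"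
    by (rule quadrangle)
  have card: "card ab = 4" "card cd = 4" "card ac = 4" "card bd = 4" "card ad = 4" "card bc = 4"
    using line_card lines k by simp_all
  obtain h where ab: "ab = {a, b, e, h}" and h: "distinct [a, b, e, h]"
    by (rule card_4_fourth_point[OF card(1) sub(1)]) (use dist in simp)
  obtain i where ac: "ac = {a, c, f, i}" and i: "distinct [a, c, f, i]"
    by (rule card_4_fourth_point[OF card(3) sub(3)]) (use dist in simp)
  obtain j where bc: "bc = {b, c, g, j}" and j: "distinct [b, c, g, j]"
    by (rule card_4_fourth_point[OF card(6) sub(6)]) (use dist in simp)
  obtain u where cd: "cd = {c, d, e, u}" and u: "distinct [c, d, e, u]"
    by (rule card_4_fourth_point[OF card(2) sub(2)]) (use dist in simp)
  obtain v where bd: "bd = {b, d, f, v}" and v: "distinct [b, d, f, v]"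
    by (rule card_4_fourth_point[OF card(4) sub(4)]) (use dist in simp)
  obtain w where ad: "ad = {a, d, g, w}" and w: "distinct [a, d, g, w]"
    by (rule card_4_fourth_point[OF card(5) sub(5)]) (use dist in simp)
  have sub4: "{a, b, e, h} \<subseteq> ab" "{a, c, f, i} \<subseteq> ac" "{b, c, g, j} \<subseteq> bc" "{c, d, e, u} \<subseteq> cd"
    "{b, d, f, v} \<subseteq> bd" "{a, d, g, w} \<subseteq> ad"
    using ab ac bc cd bd ad by simp_all
  have ab_ac: "distinct [b, e, h, c, f, i]"
  proof (rule distinct_of_crossing_lines[OF lines(1) lines(3)])
    show "ab \<noteq> ac" using dist_lines by auto
    show "{a, b, e, h} \<subseteq> ab" "{a, c, f, i} \<subseteq> ac" using sub4 by simp_all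
    show "distinct [a, b, e, h]" "distinct [a, c, f, i]" using h i by auto
  qed
  have ab_bc: "distinct [a, e, h, c, g, j]"
  proof (rule distinct_of_crossing_lines[OF lines(1) lines(6)])
    show "ab \<noteq> bc" using dist_lines by auto
    show "{b, a, e, h} \<subseteq> ab" "{b, c, g, j} \<subseteq> bc" using sub4 by simp_all
    show "distinct [b, a, e, h]" "distinct [b, c, g, j]" using h j by auto
  qed
  have ab_cd: "distinct [a, b, h, c, d, u]"
  proof (rule distinct_of_crossing_lines[OF lines(1) lines(2)])
    show "ab \<noteq> cd" using dist_lines by auto
    show "{e, a, b, h} \<subseteq> ab" "{e, c, d, u} \<subseteq> cd" using sub4 by simp_all
    show "distinct [e, a, b, h]" "distinct [e, c, d, u]" using h u by auto
  qed
  have ab_bd: "distinct [a, e, h, d, f, v]"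
  proof (rule distinct_of_crossing_lines[OF lines(1) lines(4)])
    show "ab \<noteq> bd" using dist_lines by auto
    show "{b, a, e, h} \<subseteq> ab" "{b, d, f, v} \<subseteq> bd" using sub4 by simp_all
    show "distinct [b, a, e, h]" "distinct [b, d, f, v]" using h v by auto
  qed
  have ab_ad: "distinct [b, e, h, d, g, w]"
  proof (rule distinct_of_crossing_lines[OF lines(1) lines(5)])
    show "ab \<noteq> ad" using dist_lines by auto
    show "{a, b, e, h} \<subseteq> ab" "{a, d, g, w} \<subseteq> ad" using sub4 by simp_all
    show "distinct [a, b, e, h]" "distinct [a, d, g, w]" using h w by auto
  qed
  have ac_bc: "distinct [a, f, i, b, g, j]"
  proof (rule distinct_of_crossing_lines[OF lines(3) lines(6)])
    show "ac \<noteq> bc" using dist_lines by auto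
    show "{c, a, f, i} \<subseteq> ac" "{c, b, g, j} \<subseteq> bc" using sub4 by simp_all
    show "distinct [c, a, f, i]" "distinct [c, b, g, j]" using i j by auto
  qed
  have ac_cd: "distinct [a, f, i, d, e, u]"
  proof (rule distinct_of_crossing_lines[OF lines(3) lines(2)])
    show "ac \<noteq> cd" using dist_lines by auto
    show "{c, a, f, i} \<subseteq> ac" "{c, d, e, u} \<subseteq> cd" using sub4 by simp_all
    show "distinct [c, a, f, i]" "distinct [c, d, e, u]" using i u by auto
  qed
  have ac_bd: "distinct [a, c, i, b, d, v]"
  proof (rule distinct_of_crossing_lines[OF lines(3) lines(4)])
    show "ac \<noteq> bd" using dist_lines by auto
    show "{f, a, c, i} \<subseteq> ac" "{f, b, d, v} \<subseteq> bd" using sub4 by simp_all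
    show "distinct [f, a, c, i]" "distinct [f, b, d, v]" using i v by auto
  qed
  have ac_ad: "distinct [c, f, i, d, g, w]"
  proof (rule distinct_of_crossing_lines[OF lines(3) lines(5)])
    show "ac \<noteq> ad" using dist_lines by auto
    show "{a, c, f, i} \<subseteq> ac" "{a, d, g, w} \<subseteq> ad" using sub4 by simp_all
    show "distinct [a, c, f, i]" "distinct [a, d, g, w]" using i w by auto
  qed
  have bc_cd: "distinct [b, g, j, d, e, u]"
  proof (rule distinct_of_crossing_lines[OF lines(6) lines(2)])
    show "bc \<noteq> cd" using dist_lines by auto
    show "{c, b, g, j} \<subseteq> bc" "{c, d, e, u} \<subseteq> cd" using sub4 by simp_all
    show "distinct [c, b, g, j]" "distinct [c, d, e, u]" using j u by auto
  qed
  have bc_bd: "distinct [c, g, j, d, f, v]"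
  proof (rule distinct_of_crossing_lines[OF lines(6) lines(4)])
    show "bc \<noteq> bd" using dist_lines by auto
    show "{b, c, g, j} \<subseteq> bc" "{b, d, f, v} \<subseteq> bd" using sub4 by simp_all
    show "distinct [b, c, g, j]" "distinct [b, d, f, v]" using j v by auto
  qed
  have bc_ad: "distinct [b, c, j, a, d, w]"
  proof (rule distinct_of_crossing_lines[OF lines(6) lines(5)])
    show "bc \<noteq> ad" using dist_lines by auto
    show "{g, b, c, j} \<subseteq> bc" "{g, a, d, w} \<subseteq> ad" using sub4 by simp_all
    show "distinct [g, b, c, j]" "distinct [g, a, d, w]" using j w by auto
  qed
  have cd_bd: "distinct [c, e, u, b, f, v]"
  proof (rule distinct_of_crossing_lines[OF lines(2) lines(4)])
    show "cd \<noteq> bd" using dist_lines by auto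
    show "{d, c, e, u} \<subseteq> cd" "{d, b, f, v} \<subseteq> bd" using sub4 by simp_all
    show "distinct [d, c, e, u]" "distinct [d, b, f, v]" using u v by auto
  qed
  have cd_ad: "distinct [c, e, u, a, g, w]"
  proof (rule distinct_of_crossing_lines[OF lines(2) lines(5)])
    show "cd \<noteq> ad" using dist_lines by auto
    show "{d, c, e, u} \<subseteq> cd" "{d, a, g, w} \<subseteq> ad" using sub4 by simp_all
    show "distinct [d, c, e, u]" "distinct [d, a, g, w]" using u w by auto
  qed
  have bd_ad: "distinct [b, f, v, a, g, w]"
  proof (rule distinct_of_crossing_lines[OF lines(4) lines(5)])
    show "bd \<noteq> ad" using dist_lines by auto
    show "{d, b, f, v} \<subseteq> bd" "{d, a, g, w} \<subseteq> ad" using sub4 by simp_all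
    show "distinct [d, b, f, v]" "distinct [d, a, g, w]" using v w by auto
  qed
  have all: "distinct [a, b, c, d, e, f, g, h, i, j, u, v, w]"
    using dist h i j u v w ab_ac ab_bc ab_cd ab_bd ab_ad ac_bc ac_cd ac_bd ac_ad
      bc_cd bc_bd bc_ad cd_bd cd_ad bd_ad by auto
  then have all_rev: "distinct [w, v, u, j, i, h, g, f, e, d, c, b, a]" by auto
  note ne = all[simplified] all_rev[simplified]
  have X: "{a, b, c, d, e, f, g, h, i, j, u, v, w} \<subseteq> X"
    using point_of_line[OF lines(1)] point_of_line[OF lines(2)] point_of_line[OF lines(3)]
      point_of_line[OF lines(4)] point_of_line[OF lines(5)] point_of_line[OF lines(6)]
    unfolding ab cd ac bd ad bc by simp
  have quadruple: "l = {x, y, z, t}"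
    if "l \<in> \<L>" "{x, y, z, t} \<subseteq> l" "distinct [x, y, z, t]" for l x y z t
  proof -
    have "finite l" using line_card[OF that(1)] k card_ge_0_finite by force
    then show ?thesis using card_subset_eq[OF _ that(2)] line_card[OF that(1)] k that(3) by simp
  qed
  \<comment> \<open>The fourth lines through the vertices.\<close>
  obtain ajuv where ajuv: "ajuv \<in> \<L>" "a \<in> ajuv" "j \<in> ajuv"
    using line_through[of a j] X ne by auto
  have "c \<notin> ajuv" "d \<notin> ajuv" "e \<notin> ajuv"
    using point_off_line[OF ajuv(1) lines(3) ajuv(2) ajuv(3), of c]
      point_off_line[OF ajuv(1) lines(5) ajuv(2) ajuv(3), of d]
      point_off_line[OF ajuv(1) lines(1) ajuv(2) ajuv(3), of e]
    by (simp_all add: ac ad ab ne)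
  then have u_on_ajuv: "u \<in> ajuv"
    using lines_meet[OF ajuv(1) lines(2)] unfolding cd by blast
  have "b \<notin> ajuv" "d \<notin> ajuv" "f \<notin> ajuv"
    using point_off_line[OF ajuv(1) lines(1) ajuv(2) ajuv(3), of b]
      point_off_line[OF ajuv(1) lines(5) ajuv(2) ajuv(3), of d]
      point_off_line[OF ajuv(1) lines(3) ajuv(2) ajuv(3), of f]
    by (simp_all add: ab ad ac ne)
  then have v_on_ajuv: "v \<in> ajuv"
    using lines_meet[OF ajuv(1) lines(4)] unfolding bd by blast
  have ajuv_eq: "ajuv = {a, j, u, v}"
    using quadruple[OF ajuv(1), of a j u v] ajuv u_on_ajuv v_on_ajuv by (simp add: ne)
  obtain biuw where biuw: "biuw \<in> \<L>" "b \<in> biuw" "i \<in> biuw"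
    using line_through[of b i] X ne by auto
  have "c \<notin> biuw" "d \<notin> biuw" "e \<notin> biuw"
    using point_off_line[OF biuw(1) lines(3) biuw(3) biuw(2), of c]
      point_off_line[OF biuw(1) lines(4) biuw(2) biuw(3), of d]
      point_off_line[OF biuw(1) lines(1) biuw(2) biuw(3), of e]
    by (simp_all add: ac bd ab ne)
  then have u_on_biuw: "u \<in> biuw"
    using lines_meet[OF biuw(1) lines(2)] unfolding cd by blast
  have "a \<notin> biuw" "d \<notin> biuw" "g \<notin> biuw"
    using point_off_line[OF biuw(1) lines(1) biuw(2) biuw(3), of a]
      point_off_line[OF biuw(1) lines(4) biuw(2) biuw(3), of d]
      point_off_line[OF biuw(1) lines(6) biuw(2) biuw(3), of g]
    by (simp_all add: ab bd bc ne)
  then have w_on_biuw: "w \<in> biuw"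
    using lines_meet[OF biuw(1) lines(5)] unfolding ad by blast
  have biuw_eq: "biuw = {b, i, u, w}"
    using quadruple[OF biuw(1), of b i u w] biuw u_on_biuw w_on_biuw by (simp add: ne)
  obtain chvw where chvw: "chvw \<in> \<L>" "c \<in> chvw" "h \<in> chvw"
    using line_through[of c h] X ne by auto
  have "b \<notin> chvw" "d \<notin> chvw" "f \<notin> chvw"
    using point_off_line[OF chvw(1) lines(1) chvw(3) chvw(2), of b]
      point_off_line[OF chvw(1) lines(2) chvw(2) chvw(3), of d]
      point_off_line[OF chvw(1) lines(3) chvw(2) chvw(3), of f]
    by (simp_all add: ab cd ac ne)
  then have v_on_chvw: "v \<in> chvw"
    using lines_meet[OF chvw(1) lines(4)] unfolding bd by blast
  have "a \<notin> chvw" "d \<notin> chvw" "g \<notin> chvw"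
    using point_off_line[OF chvw(1) lines(1) chvw(3) chvw(2), of a]
      point_off_line[OF chvw(1) lines(2) chvw(2) chvw(3), of d]
      point_off_line[OF chvw(1) lines(6) chvw(2) chvw(3), of g]
    by (simp_all add: ab cd bc ne)
  then have w_on_chvw: "w \<in> chvw"
    using lines_meet[OF chvw(1) lines(5)] unfolding ad by blast
  have chvw_eq: "chvw = {c, h, v, w}"
    using quadruple[OF chvw(1), of c h v w] chvw v_on_chvw w_on_chvw by (simp add: ne)
  obtain dhij where dhij: "dhij \<in> \<L>" "d \<in> dhij" "h \<in> dhij"
    using line_through[of d h] X ne by auto
  have "a \<notin> dhij" "c \<notin> dhij" "f \<notin> dhij"
    using point_off_line[OF dhij(1) lines(1) dhij(3) dhij(2), of a]
      point_off_line[OF dhij(1) lines(2) dhij(2) dhij(3), of c]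
      point_off_line[OF dhij(1) lines(4) dhij(2) dhij(3), of f]
    by (simp_all add: ab cd bd ne)
  then have i_on_dhij: "i \<in> dhij"
    using lines_meet[OF dhij(1) lines(3)] unfolding ac by blast
  have "b \<notin> dhij" "c \<notin> dhij" "g \<notin> dhij"
    using point_off_line[OF dhij(1) lines(1) dhij(3) dhij(2), of b]
      point_off_line[OF dhij(1) lines(2) dhij(2) dhij(3), of c]
      point_off_line[OF dhij(1) lines(5) dhij(2) dhij(3), of g]
    by (simp_all add: ab cd ad ne)
  then have j_on_dhij: "j \<in> dhij"
    using lines_meet[OF dhij(1) lines(6)] unfolding bc by blast
  have dhij_eq: "dhij = {d, h, i, j}"
    using quadruple[OF dhij(1), of d h i j] dhij i_on_dhij j_on_dhij by (simp add: ne)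
  \<comment> \<open>The lines joining two diagonal points; their remaining points are found on lines named above.\<close>
  obtain efjw where efjw: "efjw \<in> \<L>" "e \<in> efjw" "f \<in> efjw"
    using line_through[of e f] X ne by auto
  have "a \<notin> efjw" "u \<notin> efjw" "v \<notin> efjw"
    using point_off_line[OF efjw(1) lines(1) efjw(2) efjw(3), of a]
      point_off_line[OF efjw(1) lines(2) efjw(2) efjw(3), of u]
      point_off_line[OF efjw(1) lines(4) efjw(3) efjw(2), of v]
    by (simp_all add: ab cd bd ne)
  then have j_on_efjw: "j \<in> efjw"
    using lines_meet[OF efjw(1) ajuv(1)] unfolding ajuv_eq by blast
  have "b \<notin> efjw" "i \<notin> efjw" "u \<notin> efjw"
    using point_off_line[OF efjw(1) lines(1) efjw(2) efjw(3), of b]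
      point_off_line[OF efjw(1) lines(3) efjw(3) efjw(2), of i]
      point_off_line[OF efjw(1) lines(2) efjw(2) efjw(3), of u]
    by (simp_all add: ab ac cd ne)
  then have w_on_efjw: "w \<in> efjw"
    using lines_meet[OF efjw(1) biuw(1)] unfolding biuw_eq by blast
  have efjw_eq: "efjw = {e, f, j, w}"
    using quadruple[OF efjw(1), of e f j w] efjw j_on_efjw w_on_efjw by (simp add: ne)
  obtain egiv where egiv: "egiv \<in> \<L>" "e \<in> egiv" "g \<in> egiv"
    using line_through[of e g] X ne by auto
  have "a \<notin> egiv" "c \<notin> egiv" "f \<notin> egiv"
    using point_off_line[OF egiv(1) lines(1) egiv(2) egiv(3), of a]
      point_off_line[OF egiv(1) lines(6) egiv(3) egiv(2), of c]
      point_off_line[OF egiv(1) efjw(1) egiv(2) egiv(3), of f]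
    by (simp_all add: ab bc efjw_eq ne)
  then have i_on_egiv: "i \<in> egiv"
    using lines_meet[OF egiv(1) lines(3)] unfolding ac by blast
  have "b \<notin> egiv" "d \<notin> egiv" "f \<notin> egiv"
    using point_off_line[OF egiv(1) lines(1) egiv(2) egiv(3), of b]
      point_off_line[OF egiv(1) lines(2) egiv(2) egiv(3), of d]
      point_off_line[OF egiv(1) efjw(1) egiv(2) egiv(3), of f]
    by (simp_all add: ab cd efjw_eq ne)
  then have v_on_egiv: "v \<in> egiv"
    using lines_meet[OF egiv(1) lines(4)] unfolding bd by blast
  have egiv_eq: "egiv = {e, g, i, v}"
    using quadruple[OF egiv(1), of e g i v] egiv i_on_egiv v_on_egiv by (simp add: ne)
  obtain fghu where fghu: "fghu \<in> \<L>" "f \<in> fghu" "g \<in> fghu"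
    using line_through[of f g] X ne by auto
  have "a \<notin> fghu" "b \<notin> fghu" "e \<notin> fghu"
    using point_off_line[OF fghu(1) lines(3) fghu(2) fghu(3), of a]
      point_off_line[OF fghu(1) lines(6) fghu(3) fghu(2), of b]
      point_off_line[OF fghu(1) efjw(1) fghu(2) fghu(3), of e]
    by (simp_all add: ac bc efjw_eq ne)
  then have h_on_fghu: "h \<in> fghu"
    using lines_meet[OF fghu(1) lines(1)] unfolding ab by blast
  have "c \<notin> fghu" "d \<notin> fghu" "e \<notin> fghu"
    using point_off_line[OF fghu(1) lines(3) fghu(2) fghu(3), of c]
      point_off_line[OF fghu(1) lines(4) fghu(2) fghu(3), of d]
      point_off_line[OF fghu(1) efjw(1) fghu(2) fghu(3), of e]
    by (simp_all add: ac bd efjw_eq ne)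
  then have u_on_fghu: "u \<in> fghu"
    using lines_meet[OF fghu(1) lines(2)] unfolding cd by blast
  have fghu_eq: "fghu = {f, g, h, u}"
    using quadruple[OF fghu(1), of f g h u] fghu h_on_fghu u_on_fghu by (simp add: ne)
  \<comment> \<open>Every line through \<open>a\<close> meets \<open>bc\<close>, so the four known lines through \<open>a\<close> exhaust the plane.\<close>
  have "z \<in> {a, b, c, d, e, f, g, h, i, j, u, v, w}" if z: "z \<in> X" for z
  proof (cases "z = a")
    case False
    obtain r where r: "r \<in> \<L>" "a \<in> r" "z \<in> r"
      using line_through[of a z] X z False by auto
    obtain q where q: "q \<in> r" "q \<in> {b, c, g, j}" using lines_meet[OF r(1) lines(6)] bc by blast
    have "a \<noteq> q" using q(2) ne by auto
    then have r_eq: "r = n" if "n \<in> \<L>" "a \<in> n" "q \<in> n" for n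
      using line_unique[OF r(1) that(1) r(2) q(1) that(2,3)] by simp
    have "a \<in> ab" "b \<in> ab" "a \<in> ac" "c \<in> ac" "a \<in> ad" "g \<in> ad" "a \<in> ajuv" "j \<in> ajuv"
      unfolding ab ac ad ajuv_eq by simp_all
    then have "r = ab \<or> r = ac \<or> r = ad \<or> r = ajuv"
      using q(2) r_eq[OF lines(1)] r_eq[OF lines(3)] r_eq[OF lines(5)] r_eq[OF ajuv(1)] by blast
    then show ?thesis using r(3) ab ac ad ajuv_eq by blast
  qed simp
  then have carrier: "X = {a, b, c, d, e, f, g, h, i, j, u, v, w}" using X by blast
  \<comment> \<open>Residues 0 to 12 in this order turn the lines into the translates of \<open>{0, 1, 3, 9}\<close>.\<close>
  define xs where "xs = [a, b, c, e, g, d, v, w, f, h, j, u, i]"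
  have "distinct xs" unfolding xs_def by (simp add: ne)
  then have "bij_betw ((!) xs) {..<13} X"
    by (rule bij_betw_nth) (auto simp: xs_def carrier)
  moreover have "(\<lambda>s. xs ! ((t + s) mod 13)) ` {0, 1, 3, 9} \<in> \<L>" if "t < 13" for t
  proof -
    have "{a, b, e, h} \<in> \<L>" "{b, c, g, j} \<in> \<L>" "{c, e, d, u} \<in> \<L>" "{e, g, v, i} \<in> \<L>"
      "{g, d, w, a} \<in> \<L>" "{d, v, f, b} \<in> \<L>" "{v, w, h, c} \<in> \<L>" "{w, f, j, e} \<in> \<L>"
      "{f, h, u, g} \<in> \<L>" "{h, j, i, d} \<in> \<L>" "{j, u, a, v} \<in> \<L>" "{u, i, b, w} \<in> \<L>"
      "{i, a, c, f} \<in> \<L>"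
      using lines ajuv(1) biuw(1) chvw(1) dhij(1) efjw(1) egiv(1) fghu(1)
      unfolding ab cd ac bd ad bc ajuv_eq biuw_eq chvw_eq dhij_eq efjw_eq egiv_eq fghu_eq
      by (simp_all add: insert_commute)
    moreover have "t \<in> {0, 1, 2, 3, 4, 5, 6, 7, 8, 9, 10, 11, 12}" using that by (simp; arith)
    ultimately show ?thesis by (auto simp: xs_def)
  qed
  ultimately have "cyclic_labelling X \<L> 13 {0, 1, 3, 9} ((!) xs)"
    unfolding cyclic_labelling_def by blast
  then show thesis by (rule that)
qed

end

section \<open>Projective planes over fields\<close>

lemma dim_span_pair:
  fixes u v :: "'f::field ^ 'n"
  assumes "u \<notin> vec.span {v}" "v \<noteq> 0"
  shows "vec.dim (vec.span {u, v}) = 2"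
proof -
  have "vec.independent {u, v}" "u \<noteq> v"
    using assms vec.span_base[of u "{u}"] by (auto simp: vec.independent_insert)
  then show ?thesis
    by (simp add: vec.dim_span_eq_card_independent del: vec.dim_span)
qed

lemma subspace_span_pair_eq:
  fixes V :: "('f::field ^ 'n) set"
  assumes "vec.subspace V" "vec.dim V = 2" "u \<in> V" "v \<in> V" "u \<notin> vec.span {v}" "v \<noteq> 0"
  shows "V = vec.span {u, v}"
proof -
  have "vec.span {u, v} \<subseteq> V"
    using assms(1,3,4) by (intro vec.span_minimal) simp_all
  then show ?thesis
    using vec.subspace_dim_equal[of "vec.span {u, v}" V] assms(1,2) dim_span_pair[OF assms(5,6)] by simp
qed

lemma span_in_PG2_points: "v \<noteq> 0 \<Longrightarrow> vec.span {v} \<in> PG2_points"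
  by (simp add: PG2_points_def vec.dim_span_eq_card_independent del: vec.dim_span)

lemma PG2_point_is_span:
  assumes "P \<in> PG2_points"
  obtains v where "v \<noteq> 0" "P = vec.span {v}"
proof -
  have P: "vec.subspace P" "vec.dim P = 1" using assms by (simp_all add: PG2_points_def)
  obtain B where B: "B \<subseteq> P" "vec.independent B" "P \<subseteq> vec.span B" "card B = vec.dim P"
    by (rule vec.basis_exists)
  have "card B = 1" using B(4) P(2) by simp
  then obtain v where v: "B = {v}" by (rule card_1_singletonE)
  have "P = vec.span {v}" using B P v vec.span_minimal[of B P] by auto
  then show thesis using that B(2) v by simp
qed

lemma span_singleton_subset_iff:
  fixes V :: "('f::field ^ 'n) set"
  assumes "vec.subspace V"
  shows "vec.span {v} \<subseteq> V \<longleftrightarrow> v \<in> V"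
  using assms vec.span_base[of v "{v}"] vec.span_minimal[of "{v}" V] by auto

lemma span_singleton_eq:
  fixes u v :: "'f::field ^ 'n"
  assumes "u \<in> vec.span {v}" "u \<noteq> 0"
  shows "vec.span {u} = vec.span {v}"
proof -
  obtain c where c: "u = c *s v" using assms(1) by (auto simp: vec.span_singleton)
  then have "c \<noteq> 0" using assms(2) by auto
  then have "v = inverse c *s u" using c by (simp add: vector_smult_assoc)
  then have "v \<in> vec.span {u}" by (auto simp: vec.span_singleton)
  then show ?thesis using assms(1) by (simp add: vec.span_eq)
qed

lemma two_dim_subspace_basis:
  fixes V :: "('f::field ^ 'n) set"
  assumes "vec.subspace V" "vec.dim V = 2"
  obtains u v where "V = vec.span {u, v}" "u \<notin> vec.span {v}" "v \<noteq> 0" "u \<noteq> 0"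
proof -
  obtain B where B: "B \<subseteq> V" "vec.independent B" "V \<subseteq> vec.span B" "card B = vec.dim V"
    by (rule vec.basis_exists)
  obtain u v where uv: "B = {u, v}" "u \<noteq> v" using B(4) assms(2) by (auto simp: card_2_iff)
  have "u \<notin> vec.span {v}" "v \<noteq> 0" "u \<noteq> 0"
    using B(2) uv by (auto simp: vec.independent_insert vec.span_zero)
  moreover have "V = vec.span {u, v}" using B uv assms(1) vec.span_minimal[of B V] by auto
  ultimately show thesis using that by blast
qed

text \<open>
  A vector of the span either is a multiple of \<open>v\<close> or can be scaled to have coefficient 1 at \<open>u\<close>.
  This parametrises the line by the field and one point at infinity.
\<close>

lemma PG2_points_on_line:
  fixes u v :: "'f::field ^ 3"
  assumes uv: "u \<notin> vec.span {v}" "v \<noteq> 0"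
  shows "{P \<in> PG2_points. P \<subseteq> vec.span {u, v}} =
    insert (vec.span {v}) (range (\<lambda>t. vec.span {u + t *s v}))" (is "?L = ?R")
proof
  show "?R \<subseteq> ?L"
  proof -
    have "u + t *s v \<noteq> 0" for t
    proof
      assume "u + t *s v = 0"
      then have "u = (- t) *s v" by (simp add: eq_neg_iff_add_eq_0)
      then have "u \<in> vec.span {v}" unfolding vec.span_singleton by (rule range_eqI)
      then show False using uv(1) by simp
    qed
    moreover have "u + t *s v \<in> vec.span {u, v}" "v \<in> vec.span {u, v}" for t
      by (simp_all add: vec.span_add vec.span_scale vec.span_base)
    ultimately have "vec.span {u + t *s v} \<in> ?L" "vec.span {v} \<in> ?L" for t
      using uv(2) by (simp_all add: span_in_PG2_points span_singleton_subset_iff)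
    then show ?thesis by blast
  qed
next
  show "?L \<subseteq> ?R"
  proof
    fix P assume "P \<in> ?L"
    then obtain w where w: "w \<noteq> 0" "P = vec.span {w}" "w \<in> vec.span {u, v}"
      by (auto elim!: PG2_point_is_span simp: span_singleton_subset_iff)
    obtain c where "w - c *s u \<in> vec.span {v}"
      using w(3) vec.span_breakdown_eq by blast
    then obtain d where "w - c *s u = d *s v" by (auto simp: vec.span_singleton)
    then have d: "w = c *s u + d *s v" by (simp add: diff_eq_eq add.commute)
    show "P \<in> ?R"
    proof (cases "c = 0")
      case True
      then have "w \<in> vec.span {v}" using d by (auto simp: vec.span_singleton)
      then have "P = vec.span {v}" using span_singleton_eq[OF _ w(1)] w(2) by simp
      then show ?thesis by simp
    next
      case False
      then have "w = c *s (u + (d / c) *s v)"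
        using d by (simp add: vector_add_ldistrib vector_smult_assoc)
      then have "w \<in> vec.span {u + (d / c) *s v}" by (auto simp: vec.span_singleton)
      then have "P = vec.span {u + (d / c) *s v}" using span_singleton_eq[OF _ w(1)] w(2) by simp
      then show ?thesis by blast
    qed
  qed
qed

lemma card_PG2_points_on_line:
  fixes u v :: "'f::{field, finite} ^ 3"
  assumes uv: "u \<notin> vec.span {v}" "v \<noteq> 0"
  shows "card {P \<in> PG2_points. P \<subseteq> vec.span {u, v}} = CARD('f) + 1"
proof -
  have no: "c = 0" if "c *s u \<in> vec.span {v}" for c
  proof (rule ccontr)
    assume "c \<noteq> 0"
    then have "inverse c *s (c *s u) = u" by (simp add: vector_smult_assoc)
    then show False using vec.span_scale[OF that, of "inverse c"] uv(1) by simp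
  qed
  have "inj (\<lambda>t. vec.span {u + t *s v})"
  proof (rule injI)
    fix s t assume "vec.span {u + s *s v} = vec.span {u + t *s v}"
    then have "u + s *s v \<in> vec.span {u + t *s v}" using vec.span_base by blast
    then obtain c where c: "u + s *s v = c *s (u + t *s v)" by (auto simp: vec.span_singleton)
    then have eq: "(1 - c) *s u = (c * t - s) *s v"
      by (simp add: vector_add_ldistrib vector_smult_assoc vector_sub_rdistrib algebra_simps)
    then have "(1 - c) *s u \<in> vec.span {v}" by (auto simp: vec.span_singleton)
    then have "c = 1" using no by fastforce
    then show "s = t" using eq uv(2) by simp
  qed
  moreover have "vec.span {v} \<notin> range (\<lambda>t. vec.span {u + t *s v})"
  proof
    assume "vec.span {v} \<in> range (\<lambda>t. vec.span {u + t *s v})"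
    then obtain t where "u + t *s v \<in> vec.span {v}" using vec.span_base by blast
    then have "u \<in> vec.span {v}"
      using vec.span_diff[of "u + t *s v" "{v}" "t *s v"] by (simp add: vec.span_scale vec.span_base)
    then show False using uv by simp
  qed
  ultimately show ?thesis
    unfolding PG2_points_on_line[OF uv] by (simp add: card_image)
qed

lemma linear_space_PG2: "linear_space (PG2_points :: ('f::field ^ 3) set set) PG2_lines"
  unfolding linear_space_def
proof (intro conjI ballI impI)
  fix l :: "('f ^ 3) set set"
  assume "l \<in> PG2_lines"
  then obtain V where V: "l = {P \<in> PG2_points. P \<subseteq> V}" "vec.subspace V" "vec.dim V = 2"
    by (auto simp: PG2_lines_def)
  then show "l \<subseteq> PG2_points" by blast
  obtain u v where uv: "V = vec.span {u, v}" "u \<notin> vec.span {v}" "v \<noteq> 0" "u \<noteq> 0"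
    using two_dim_subspace_basis[OF V(2,3)] .
  have "vec.span {u} \<in> l" "vec.span {v} \<in> l"
    using V uv by (simp_all add: span_in_PG2_points span_singleton_subset_iff vec.span_base)
  moreover have "vec.span {u} \<noteq> vec.span {v}"
    using uv(2) vec.span_base[of u "{u}"] by auto
  ultimately show "\<exists>x\<in>l. \<exists>y\<in>l. x \<noteq> y" by blast
next
  fix P Q :: "('f ^ 3) set"
  assume "P \<in> PG2_points" "Q \<in> PG2_points" "P \<noteq> Q"
  then obtain u v where uv: "u \<noteq> 0" "P = vec.span {u}" "v \<noteq> 0" "Q = vec.span {v}"
    by (metis PG2_point_is_span)
  have off: "u \<notin> vec.span {v}" using span_singleton_eq \<open>P \<noteq> Q\<close> uv by blast
  let ?l = "\<lambda>V. {P \<in> PG2_points. P \<subseteq> V}"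
  let ?V = "vec.span {u, v}"
  show "\<exists>!l. l \<in> PG2_lines \<and> P \<in> l \<and> Q \<in> l"
  proof (rule ex1I[of _ "?l ?V"])
    have "?l ?V \<in> PG2_lines"
      using dim_span_pair[OF off uv(3)] unfolding PG2_lines_def by blast
    then show "?l ?V \<in> PG2_lines \<and> P \<in> ?l ?V \<and> Q \<in> ?l ?V"
      using uv by (simp add: span_in_PG2_points span_singleton_subset_iff vec.span_base)
  next
    fix l assume l: "l \<in> PG2_lines \<and> P \<in> l \<and> Q \<in> l"
    then obtain V where V: "l = ?l V" "vec.subspace V" "vec.dim V = 2"
      by (auto simp: PG2_lines_def)
    then have "u \<in> V" "v \<in> V" using l uv by (simp_all add: span_singleton_subset_iff)
    then show "l = ?l ?V" using subspace_span_pair_eq[OF V(2,3)] off uv(3) V(1) by simp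
  qed
qed

text \<open>
  By the dimension formula two planes in a three-dimensional space share a nonzero vector.
\<close>

lemma PG2_lines_meet:
  fixes l m :: "('f::field ^ 3) set set"
  assumes "l \<in> PG2_lines" "m \<in> PG2_lines"
  shows "l \<inter> m \<noteq> {}"
proof -
  obtain V where V: "l = {P \<in> PG2_points. P \<subseteq> V}" "vec.subspace V" "vec.dim V = 2"
    using assms(1) by (auto simp: PG2_lines_def)
  obtain W where W: "m = {P \<in> PG2_points. P \<subseteq> W}" "vec.subspace W" "vec.dim W = 2"
    using assms(2) by (auto simp: PG2_lines_def)
  have "vec.dim {x + y |x y. x \<in> V \<and> y \<in> W} \<le> 3"
    using dim_subset_UNIV_cart_gen[of "{x + y |x y. x \<in> V \<and> y \<in> W}"] by simp
  then have "vec.dim (V \<inter> W) \<noteq> 0"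
    using vec.dim_sums_Int[OF V(2) W(2)] V(3) W(3) by linarith
  then obtain v where v: "v \<in> V" "v \<in> W" "v \<noteq> 0" by (auto simp: vec.dim_eq_0)
  then have "vec.span {v} \<in> l \<inter> m"
    using V W by (simp add: span_in_PG2_points span_singleton_subset_iff)
  then show ?thesis by blast
qed

lemma PG2_two_lines: "\<exists>l\<in>PG2_lines. \<exists>m\<in>PG2_lines. l \<noteq> (m :: ('f::field ^ 3) set set)"
proof -
  let ?B = "cart_basis :: ('f ^ 3) set"
  have B: "vec.independent ?B" "card ?B = 3"
    using independent_cart_basis card_cart_basis[where 'a = 'f and 'i = 3] by simp_all
  then obtain x y z where xyz: "?B = {x, y, z}" "x \<noteq> y" "y \<noteq> z" "x \<noteq> z"
    by (auto simp: card_3_iff)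
  have "vec.independent {z, x, y}" "vec.independent {x, y}" "vec.independent {x, z}"
    using B(1) xyz(1) by (auto elim!: vec.independent_mono)
  then have z: "z \<notin> vec.span {x, y}" and xy: "x \<notin> vec.span {y}" "y \<noteq> 0"
    and xz: "x \<notin> vec.span {z}" "z \<noteq> 0"
    using xyz(2-4) by (simp_all add: vec.independent_insert)
  define l m where "l = {P \<in> PG2_points. P \<subseteq> vec.span {x, y}}"
    and "m = {P \<in> PG2_points. P \<subseteq> vec.span {x, z}}"
  have "l \<in> PG2_lines" "m \<in> PG2_lines"
    unfolding l_def m_def PG2_lines_def using dim_span_pair[OF xy] dim_span_pair[OF xz] by blast+
  moreover have "vec.span {z} \<in> m" "vec.span {z} \<notin> l"
    using z xz(2)
    by (simp_all add: l_def m_def span_in_PG2_points span_singleton_subset_iff vec.span_base)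
  ultimately show ?thesis by blast
qed

lemma projective_plane_PG2:
  "projective_plane_locale (PG2_points :: ('f::{field, finite} ^ 3) set set) PG2_lines (CARD('f) + 1)"
proof
  show "card l = CARD('f) + 1" if "l \<in> PG2_lines" for l :: "('f ^ 3) set set"
  proof -
    obtain V where V: "l = {P \<in> PG2_points. P \<subseteq> V}" "vec.subspace V" "vec.dim V = 2"
      using \<open>l \<in> PG2_lines\<close> by (auto simp: PG2_lines_def)
    obtain u v where "V = vec.span {u, v}" "u \<notin> vec.span {v}" "v \<noteq> 0"
      using two_dim_subspace_basis[OF V(2,3)] .
    then show ?thesis using card_PG2_points_on_line V(1) by simp
  qed
qed (use linear_space_PG2 PG2_lines_meet PG2_two_lines in blast)+

section \<open>Classification of homogeneous linear spaces\<close>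

text \<open>
  The bound on the line size is obtained for two lines \<open>l0\<close> and \<open>m0\<close> only; as all lines have equal
  cardinality, it determines the size of every line and rules out infinite lines.
\<close>

lemma (in homogeneous_linear_space) projective_plane_of_homogeneous:
  assumes nontrivial: "\<not> trivial_space \<L>" and noncollinear: "\<not> collinear_in \<L> X"
  shows "projective_plane_locale X \<L> 3 \<or> projective_plane_locale X \<L> 4"
proof -
  obtain l0 where l0: "l0 \<in> \<L>" "card l0 \<noteq> 2" using nontrivial by (auto simp: trivial_space_def)
  have third: "\<exists>z\<in>l. z \<noteq> x \<and> z \<noteq> y" if l: "l \<in> \<L>" for l x y
  proof (rule ccontr)
    assume none: "\<not> (\<exists>z\<in>l. z \<noteq> x \<and> z \<noteq> y)"
    obtain s where s: "s \<in> l" using other_point_on_line[OF l] by blast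
    obtain t where t: "t \<in> l" "t \<noteq> s" using other_point_on_line[OF l] by blast
    have "l \<subseteq> {x, y}" using none by blast
    then have "l = {s, t}" using s t by auto
    then have "card l = 2" using t(2) by simp
    then show False using card_lines_eq[OF l l0(1)] l0(2) by simp
  qed
  have meet: "l \<inter> m \<noteq> {}" if "l \<in> \<L>" "m \<in> \<L>" for l m
    using lines_meet third that by blast
  obtain c where c: "c \<in> X" "c \<notin> l0" using noncollinear l0(1) by (auto simp: collinear_in_def)
  obtain e where e: "e \<in> l0" using third[OF l0(1)] by blast
  have "e \<in> X" "e \<noteq> c" using e c l0(1) point_of_line by blast+
  then obtain m0 where m0: "m0 \<in> \<L>" "e \<in> m0" "c \<in> m0" using line_through c(1) by metis
  have "l0 \<noteq> m0" using m0 c by blast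
  obtain a where a: "a \<in> l0" "a \<noteq> e" using third[OF l0(1)] by blast
  obtain b where b: "b \<in> l0" "b \<noteq> e" "b \<noteq> a" using third[OF l0(1)] by blast
  obtain d where d: "d \<in> m0" "d \<noteq> e" "d \<noteq> c" using third[OF m0(1)] by blast
  have "card l0 = 3 \<or> card m0 = 4"
    using line_card_of_quadrangle[OF meet l0(1) m0(1) \<open>l0 \<noteq> m0\<close> a(1) b(1) e _ _ _ m0(3) d(1) m0(2)]
      a b d \<open>e \<noteq> c\<close> by blast
  moreover have "projective_plane_locale X \<L> (card l)" if "l \<in> \<L>" for l
    using meet card_lines_eq[OF _ that] l0(1) m0(1) \<open>l0 \<noteq> m0\<close> by unfold_locales blast+
  ultimately show ?thesis using l0(1) m0(1) by metis
qed

theorem theorem3p8: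
  fixes X :: "'a set" and \<L> :: "'a set set"
  assumes "linear_space X \<L>"
    and "homogeneous X \<L>"
  shows "trivial_space \<L>
    \<or> collinear_in \<L> X
    \<or> isomorphic_spaces X \<L> (PG2_points :: (F2 ^ 3) set set) PG2_lines
    \<or> isomorphic_spaces X \<L> (PG2_points :: (F3 ^ 3) set set) PG2_lines"
proof -
  interpret homogeneous_linear_space X \<L>
    using assms by unfold_locales
  have order_2: "isomorphic_spaces X \<L> (PG2_points :: (F2 ^ 3) set set) PG2_lines"
    if plane: "projective_plane_locale X \<L> 3"
  proof -
    have PG: "projective_plane_locale (PG2_points :: (F2 ^ 3) set set) PG2_lines 3"
      using projective_plane_PG2[where 'f = F2] by (simp add: card_F2)
    obtain p where p: "cyclic_labelling X \<L> 7 {0, 1, 3} p"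
      using projective_plane_locale.cyclic_labelling_order_2[OF plane refl] .
    obtain r where r: "cyclic_labelling (PG2_points :: (F2 ^ 3) set set) PG2_lines 7 {0, 1, 3} r"
      using projective_plane_locale.cyclic_labelling_order_2[OF PG refl] .
    show ?thesis
      using isomorphic_of_cyclic_labellings[OF linear linear_space_PG2 p r difference_set_7] .
  qed
  have order_3: "isomorphic_spaces X \<L> (PG2_points :: (F3 ^ 3) set set) PG2_lines"
    if plane: "projective_plane_locale X \<L> 4"
  proof -
    have PG: "projective_plane_locale (PG2_points :: (F3 ^ 3) set set) PG2_lines 4"
      using projective_plane_PG2[where 'f = F3] by (simp add: card_F3)
    obtain p where p: "cyclic_labelling X \<L> 13 {0, 1, 3, 9} p"
      using projective_plane_locale.cyclic_labelling_order_3[OF plane refl] .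
    obtain r where r: "cyclic_labelling (PG2_points :: (F3 ^ 3) set set) PG2_lines 13 {0, 1, 3, 9} r"
      using projective_plane_locale.cyclic_labelling_order_3[OF PG refl] .
    show ?thesis
      using isomorphic_of_cyclic_labellings[OF linear linear_space_PG2 p r difference_set_13] .
  qed
  show ?thesis using projective_plane_of_homogeneous order_2 order_3 by blast
qed

end
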